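(* Fix $\lambda>0$. For each integer $n>\lambda$ let $p_i=\frac{\lambda}{n}\left(1-\frac{\lambda}{n}\right)^{i-1}$ for $1\le i\le n$, let $T_1,\dots,T_n$ be independent random variables with $T_i\sim\mathrm{Exp}(p_i)$, let $T=T^{(n)}=\max_{1\le i\le n}T_i$, and let $$T'=\frac{T-\frac{e^{\lambda}}{\lambda}\, n(\log n-\log\log n)}{n}.$$ Let $F_{T'}$ be the distribution function of $T'$. Then for each fixed $t'\in\mathbb R$, as $n\to\infty$, $$F_{T'}(t')=\exp\left(-\exp\left(-\frac{t'-\left(-\frac{e^{\lambda}}{\lambda}\log\lambda\right)}{e^{\lambda}/\lambda}\right)\right)+O\left(\frac{\log\log n}{\log n}\right).$$
   Context: $\log$ is the natural logarithm. $\mathrm{Exp}(p)$ is the exponential distribution with rate $p$, i.e. $P(T_i>t)=e^{-p_i t}$ for $t\ge 0$. The constant implied in the $O$-term may depend on $\lambda$ and $t'$. ($T$ is the time to collect all $n$ coupon types in a continuous-time coupon collector's model in which type $i$ arrives at rate $p_i$.) *)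

theory Defs
  imports "HOL-Probability.Probability" "HOL-Library.Landau_Symbols"
begin

text \<open>Coupon types are numbered \<open>1, \<dots>, n\<close>, so \<open>i - 1\<close> below never truncates.\<close>

definition coupon_rate :: "real \<Rightarrow> nat \<Rightarrow> nat \<Rightarrow> real" where
  "coupon_rate lam n i = lam / real n * (1 - lam / real n) ^ (i - 1)"

definition collection_time :: "nat \<Rightarrow> (nat \<Rightarrow> 'a \<Rightarrow> real) \<Rightarrow> 'a \<Rightarrow> real" where
  "collection_time n T \<omega> = Max ((\<lambda>i. T i \<omega>) ` {1..n})"

definition normalized_time :: "real \<Rightarrow> nat \<Rightarrow> (nat \<Rightarrow> 'a \<Rightarrow> real) \<Rightarrow> 'a \<Rightarrow> real" where
  "normalized_time lam n T \<omega> =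
     (collection_time n T \<omega> - exp lam / lam * real n * (ln (real n) - ln (ln (real n)))) / real n"

end

theory Submission
  imports Defs "HOL-Real_Asymp.Real_Asymp"
begin

text \<open>
  Independence turns the distribution function into the product of the factors
  \<open>1 - exp (- h\<^sub>i)\<close>, where \<open>h\<^sub>i = x q\<^sup>i\<close> is geometric with ratio \<open>q = 1 - \<lambda> / n\<close>.
  All subtracted terms are \<open>O(ln n / n)\<close>, so the product is close to \<open>exp (- S)\<close> with
  \<open>S = \<Sum> exp (- h\<^sub>i)\<close>. The function \<open>G h = exp (- h) / h\<close> is an approximate discrete
  antiderivative: \<open>G h\<^sub>i\<^sub>+\<^sub>1 - G h\<^sub>i\<close> lies between \<open>(1 - q) exp (- h\<^sub>i)\<close> and
  \<open>(1 - q) (1 + 1 / h\<^sub>i\<^sub>+\<^sub>1) exp (- h\<^sub>i\<^sub>+\<^sub>1)\<close>. Telescoping encloses \<open>S\<close> between two explicit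
  functions of \<open>n\<close> with the same limit.
\<close>

section \<open>Sums of exponentials of a geometric sequence\<close>

lemma sum_exp_geometric_le:
  fixes x q :: real
  assumes "x > 0" "0 < q" "q < 1"
  shows "(1 - q) * (\<Sum>i<n. exp (- (x * q ^ i))) \<le> exp (- (x * q ^ n)) / (x * q ^ n)"
proof -
  define G where "G = (\<lambda>i. exp (- (x * q ^ i)) / (x * q ^ i))"
  have step: "(1 - q) * exp (- (x * q ^ i)) \<le> G (Suc i) - G i" for i
  proof -
    define h where "h = x * q ^ i"
    have h: "h > 0" using assms by (simp add: h_def)
    have "exp (- h) * (1 + (1 - q) * h) \<le> exp (- h) * exp ((1 - q) * h)"
      by (intro mult_left_mono exp_ge_add_one_self) auto
    also have "\<dots> = exp (- (q * h))"
      by (simp add: algebra_simps flip: exp_add)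
    finally have "exp (- h) * (1 + (1 - q) * h) / h \<le> exp (- (q * h)) / h"
      using h by (simp add: divide_right_mono)
    also have "\<dots> \<le> exp (- (q * h)) / (q * h)"
      using h assms by (intro divide_left_mono) auto
    finally have "exp (- h) / h + (1 - q) * exp (- h) \<le> exp (- (q * h)) / (q * h)"
      using h by (simp add: field_simps)
    then show ?thesis by (simp add: G_def h_def mult_ac)
  qed
  have "(1 - q) * (\<Sum>i<n. exp (- (x * q ^ i))) \<le> (\<Sum>i<n. G (Suc i) - G i)"
    unfolding sum_distrib_left by (intro sum_mono step)
  also have "\<dots> = G n - G 0" by (rule sum_lessThan_telescope)
  also have "\<dots> \<le> G n" using assms by (simp add: G_def)
  finally show ?thesis by (simp add: G_def)
qed

text \<open>The same inequality at y = -(1 - q) h reverses the estimate, at the cost of the factor 1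
  + 1 / h. Here \<open>G 0\<close> has the wrong sign to be dropped and stays as
  \<open>exp (- x) / x\<close>.\<close>

lemma sum_exp_geometric_ge:
  fixes x q :: real
  assumes "x > 0" "0 < q" "q < 1"
  shows "exp (- (x * q ^ k)) / (x * q ^ k) - exp (- x) / x
    \<le> (1 - q) * (1 + 1 / (x * q ^ k)) * (\<Sum>i<Suc k. exp (- (x * q ^ i)))"
proof -
  define G where "G = (\<lambda>i. exp (- (x * q ^ i)) / (x * q ^ i))"
  have step: "G (Suc i) - G i \<le> (1 - q) * (1 + 1 / (x * q ^ k)) * exp (- (x * q ^ Suc i))"
    if "i < k" for i
  proof -
    define h where "h = x * q ^ i"
    have h: "h > 0" using assms by (simp add: h_def)
    have "exp (- (q * h)) * (1 - (1 - q) * h) \<le> exp (- (q * h)) * exp (- ((1 - q) * h))"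
      using exp_ge_add_one_self[of "- ((1 - q) * h)"] by (intro mult_left_mono) auto
    also have "\<dots> = exp (- h)"
      by (simp add: algebra_simps flip: exp_add)
    finally have "exp (- (q * h)) * (1 - (1 - q) * h) / h \<le> exp (- h) / h"
      using h by (simp add: divide_right_mono)
    moreover have "exp (- (q * h)) * (1 - (1 - q) * h) / h = exp (- (q * h)) / h - (1 - q) * exp (- (q * h))"
      using h by (simp add: field_simps)
    moreover have "(1 - q) * (1 + 1 / (q * h)) * exp (- (q * h))
        = (1 - q) * exp (- (q * h)) + exp (- (q * h)) / (q * h) - exp (- (q * h)) / h"
      using h assms by (simp add: field_simps)
    ultimately have "exp (- (q * h)) / (q * h) - exp (- h) / h
        \<le> (1 - q) * (1 + 1 / (q * h)) * exp (- (q * h))"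
      by linarith
    \<comment> \<open>The exponents decrease with the index, so the correction factor is largest at
      \<open>k\<close>; this makes it uniform in \<open>i\<close>.\<close>
    also have "\<dots> \<le> (1 - q) * (1 + 1 / (x * q ^ k)) * exp (- (q * h))"
    proof -
      have "q ^ k \<le> q ^ Suc i"
        using assms that by (intro power_decreasing) auto
      then have "x * q ^ k \<le> q * h"
        using assms by (simp add: h_def mult_ac)
      then have "1 / (q * h) \<le> 1 / (x * q ^ k)"
        using assms h by (intro divide_left_mono) auto
      then show ?thesis using assms by (intro mult_right_mono mult_left_mono) auto
    qed
    finally show ?thesis by (simp add: G_def h_def mult_ac)
  qed
  have "exp (- (x * q ^ k)) / (x * q ^ k) - exp (- x) / x = G k - G 0"
    by (simp add: G_def)
  also have "\<dots> = (\<Sum>i<k. G (Suc i) - G i)" by (rule sum_lessThan_telescope[symmetric])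
  also have "\<dots> \<le> (\<Sum>i<k. (1 - q) * (1 + 1 / (x * q ^ k)) * exp (- (x * q ^ Suc i)))"
    by (intro sum_mono step) auto
  also have "\<dots> = (1 - q) * (1 + 1 / (x * q ^ k)) * (\<Sum>i<k. exp (- (x * q ^ Suc i)))"
    by (simp only: sum_distrib_left)
  \<comment> \<open>The shifted sum lacks only the nonnegative term at index 0.\<close>
  also have "\<dots> \<le> (1 - q) * (1 + 1 / (x * q ^ k)) * (\<Sum>i<Suc k. exp (- (x * q ^ i)))"
    using assms by (intro mult_left_mono) (auto simp: sum.lessThan_Suc_shift simp del: sum.lessThan_Suc)
  finally show ?thesis .
qed

section \<open>Products close to one\<close>

lemma prod_one_minus_le_exp_sum:
  fixes f :: "'a \<Rightarrow> real"
  assumes "\<And>i. i \<in> A \<Longrightarrow> f i \<le> 1"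
  shows "(\<Prod>i\<in>A. 1 - f i) \<le> exp (- (\<Sum>i\<in>A. f i))"
proof (cases "finite A")
  case True
  have "(\<Prod>i\<in>A. 1 - f i) \<le> (\<Prod>i\<in>A. exp (- f i))"
    using exp_ge_add_one_self[of "- f _"] assms by (intro prod_mono) auto
  then show ?thesis using True by (simp add: exp_sum sum_negf flip: sum_negf)
qed auto

text \<open>Follows from ln (1 - y) \<ge> -y - 2 y^2 on [0, 1/2], where y \<le> m turns the
  quadratic term into at most 2 m y.\<close>

lemma prod_one_minus_ge_exp_sum:
  fixes f :: "'a \<Rightarrow> real"
  assumes "\<And>i. i \<in> A \<Longrightarrow> 0 \<le> f i \<and> f i \<le> m" "m \<le> 1 / 2"
  shows "exp (- ((1 + 2 * m) * (\<Sum>i\<in>A. f i))) \<le> (\<Prod>i\<in>A. 1 - f i)"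
proof (cases "finite A")
  case True
  have step: "exp (- ((1 + 2 * m) * f i)) \<le> 1 - f i" if "i \<in> A" for i
  proof -
    have f: "0 \<le> f i" "f i \<le> m" "f i \<le> 1 / 2" using assms that by force+
    have "f i * f i \<le> m * f i" using f by (intro mult_right_mono) auto
    then have "- ((1 + 2 * m) * f i) \<le> - f i - 2 * (f i)\<^sup>2"
      by (simp add: power2_eq_square algebra_simps)
    also have "\<dots> \<le> ln (1 - f i)" using f by (intro ln_one_minus_pos_lower_bound) auto
    finally show ?thesis using f by (simp add: ln_ge_iff)
  qed
  have "(\<Prod>i\<in>A. exp (- ((1 + 2 * m) * f i))) \<le> (\<Prod>i\<in>A. 1 - f i)"
    using step by (intro prod_mono) auto
  then show ?thesis
    using True by (simp add: exp_sum sum_distrib_left flip: sum_negf)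
qed auto

text \<open>One-sided Lipschitz bound: the slope is at most \<open>exp (- a)\<close>, hence at most
  1; the sign of \<open>b\<close> is free.\<close>

lemma exp_minus_diff_le:
  fixes a b :: real
  assumes "a \<ge> 0"
  shows "exp (- a) - exp (- b) \<le> max 0 (b - a)"
proof (cases "b \<le> a")
  case False
  have "1 - (b - a) \<le> exp (a - b)"
    using exp_ge_add_one_self[of "a - b"] by linarith
  then have "exp (- a) * (1 - (b - a)) \<le> exp (- a) * exp (a - b)"
    by (intro mult_left_mono) auto
  also have "\<dots> = exp (- b)" by (simp flip: exp_add)
  finally have "exp (- a) - exp (- b) \<le> exp (- a) * (b - a)" by (simp add: algebra_simps)
  also have "\<dots> \<le> 1 * (b - a)" using assms False by (intro mult_right_mono) auto
  finally show ?thesis by simp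
qed auto

text \<open>A larger sum means a smaller product, so \<open>l\<close> controls the product from
  above and \<open>u\<close> from below. The factor 2 comes from 1 + 2 m \<le> 2, and
  \<open>2 * a * m\<close> is (1 + 2 m) a - a.\<close>

lemma prod_one_minus_approx:
  fixes f :: "'a \<Rightarrow> real"
  assumes f: "\<And>i. i \<in> A \<Longrightarrow> 0 \<le> f i \<and> f i \<le> m" and m: "0 \<le> m" "m \<le> 1 / 2"
    and a: "a \<ge> 0" and l: "l \<le> (\<Sum>i\<in>A. f i)" and u: "(\<Sum>i\<in>A. f i) \<le> u"
  shows "\<bar>(\<Prod>i\<in>A. 1 - f i) - exp (- a)\<bar> \<le> \<bar>l - a\<bar> + 2 * \<bar>u - a\<bar> + 2 * a * m"
proof -
  define S where "S = (\<Sum>i\<in>A. f i)"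
  have S: "S \<ge> 0" unfolding S_def using f by (intro sum_nonneg) auto
  have f1: "f i \<le> 1" if "i \<in> A" for i using f[OF that] m by linarith
  have "(\<Prod>i\<in>A. 1 - f i) - exp (- a) \<le> exp (- S) - exp (- a)"
    using prod_one_minus_le_exp_sum[of A f] f1 by (simp add: S_def)
  also have "\<dots> \<le> max 0 (a - S)" by (rule exp_minus_diff_le[OF S])
  also have "\<dots> \<le> \<bar>l - a\<bar>" using l by (simp add: S_def)
  finally have up: "(\<Prod>i\<in>A. 1 - f i) - exp (- a) \<le> \<bar>l - a\<bar>" .
  have "exp (- a) - (\<Prod>i\<in>A. 1 - f i) \<le> exp (- a) - exp (- ((1 + 2 * m) * S))"
    using prod_one_minus_ge_exp_sum[of A f m] f m by (simp add: S_def)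
  also have "\<dots> \<le> max 0 ((1 + 2 * m) * S - a)" by (rule exp_minus_diff_le[OF a])
  also have "\<dots> \<le> 2 * \<bar>u - a\<bar> + 2 * a * m"
  proof -
    have "(1 + 2 * m) * S \<le> (1 + 2 * m) * u"
      using u m by (intro mult_left_mono) (auto simp: S_def)
    moreover have "(1 + 2 * m) * (u - a) \<le> (1 + 2 * m) * \<bar>u - a\<bar>"
      using m by (intro mult_left_mono) auto
    moreover have "(1 + 2 * m) * \<bar>u - a\<bar> \<le> 2 * \<bar>u - a\<bar>"
      using m by (intro mult_right_mono) auto
    ultimately have "(1 + 2 * m) * S - a \<le> 2 * \<bar>u - a\<bar> + 2 * a * m"
      by (simp add: algebra_simps)
    moreover have "0 \<le> 2 * \<bar>u - a\<bar> + 2 * a * m" using a m by simp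
    ultimately show ?thesis by simp
  qed
  finally have "exp (- a) - (\<Prod>i\<in>A. 1 - f i) \<le> 2 * \<bar>u - a\<bar> + 2 * a * m" .
  moreover have "0 \<le> 2 * a * m" "0 \<le> \<bar>l - a\<bar>" "0 \<le> 2 * \<bar>u - a\<bar>" using a m by simp_all
  ultimately show ?thesis using up unfolding abs_le_iff by linarith
qed

section \<open>Asymptotics\<close>

text \<open>Since (1 - lam/n)^n tends to exp (-lam), the smallest exponents are close to
  \<open>w n\<close>, and the sum of the exponentials tends to
  \<open>exp (- \<tau>) / lam\<close>.\<close>

lemma geometric_product_asymp:
  fixes lam \<tau> :: real
  assumes lam: "lam > 0"
  defines "w \<equiv> \<lambda>n. \<tau> + ln (real n) - ln (ln (real n))"
  shows "(\<lambda>n. (\<Prod>i<n. 1 - exp (- (exp lam * w n * (1 - lam / real n) ^ i)))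
      - exp (- (exp (- \<tau>) / lam))) \<in> O(\<lambda>n. ln (ln (real n)) / ln (real n))"
proof -
  define g where "g = (\<lambda>n. ln (ln (real n)) / ln (real n))"
  define a where "a = exp (- \<tau>) / lam"
  \<comment> \<open>\<open>h\<close> and \<open>h'\<close> are the terms \<open>h\<^sub>n\<close> and \<open>h\<^sub>n\<^sub>-\<^sub>1\<close>; writing \<open>e\<^sup>\<lambda> (1 - \<lambda> / n)\<^sup>n\<close> as a single
    exponential lets \<open>real_asymp\<close> see the cancellation.\<close>
  define h where "h = (\<lambda>n. w n * exp (lam + real n * ln (1 - lam / real n)))"
  define h' where "h' = (\<lambda>n. w n * exp (lam + (real n - 1) * ln (1 - lam / real n)))"
  \<comment> \<open>\<open>u\<close> and \<open>l\<close> are the upper and lower bounds for the sum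
    that telescoping gives, solved for the sum.\<close>
  define u where "u = (\<lambda>n. real n / lam * (exp (- h n) / h n))"
  define l where "l = (\<lambda>n. real n / lam
    * (exp (- h' n) / h' n - exp (- (exp lam * w n)) / (exp lam * w n))
    / (1 + 1 / h' n))"
  \<comment> \<open>Isolates \<open>w n - y\<close>, which tends to 0 for y = \<open>h n\<close> and
    y = \<open>h' n\<close>, from the factor ln n / n.\<close>
  have split_exp: "exp (- y) = exp (- \<tau>) * (exp (w n - y) * exp (- (ln n - ln (ln n))))" for y n
    by (simp add: w_def algebra_simps flip: exp_add)
  \<comment> \<open>The expression behaves like ln n / \<open>w n\<close> - 1, and this is where the
    rate ln ln n / ln n arises.\<close>
  have "(\<lambda>n. real n * exp (w n - h n) * exp (- (ln n - ln (ln n))) / h n - 1) \<in> O(g)"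
    using lam unfolding w_def h_def g_def by real_asymp
  then have "(\<lambda>n. a * (real n * exp (w n - h n) * exp (- (ln n - ln (ln n))) / h n - 1)) \<in> O(g)"
    using lam by (subst landau_o.big.cmult_in_iff) (auto simp: a_def)
  also have "(\<lambda>n. a * (real n * exp (w n - h n)
      * exp (- (ln n - ln (ln n))) / h n - 1)) = (\<lambda>n. u n - a)"
    unfolding u_def split_exp[of "h n" n for n] by (simp add: a_def algebra_simps)
  finally have u: "(\<lambda>n. u n - a) \<in> O(g)" .
  have l1: "(\<lambda>n. real n * exp (w n - h' n) * exp (- (ln n - ln (ln n))) / h' n / (1 + 1 / h' n) - 1) \<in> O(g)"
    using lam unfolding w_def h'_def g_def by real_asymp
  \<comment> \<open>The initial term \<open>G 0\<close> is negligible: up to logarithmic factors it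
    contributes n^(1 - b), with b = \<open>exp lam\<close> > 1.\<close>
  have "(\<lambda>n::nat. let w = \<tau> + ln n - ln (ln n); d = lam + (real n - 1) * ln (1 - lam / n) in
    n * exp (- b * w) / (b * w) / (1 + 1 / (w * exp d))) \<in> O(g)" if "b > 1" for b
    using lam that unfolding g_def Let_def by real_asymp
  from this[of "exp lam"] lam
  have l2: "(\<lambda>n. real n * exp (- (exp lam * w n)) / (exp lam * w n) / (1 + 1 / h' n)) \<in> O(g)"
    by (simp add: w_def h'_def Let_def)
  have "(\<lambda>n. a * (real n * exp (w n - h' n) * exp (- (ln n - ln (ln n))) / h' n / (1 + 1 / h' n) - 1)
      - 1 / lam * (real n * exp (- (exp lam * w n)) / (exp lam * w n) / (1 + 1 / h' n))) \<in> O(g)"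
    using l1 l2 lam
    by (intro sum_in_bigo(2)[OF landau_o.big.cmult_in_iff[THEN iffD2]
          landau_o.big.cmult_in_iff[THEN iffD2]]) (auto simp: a_def)
  also have "(\<lambda>n. a * (real n * exp (w n - h' n) * exp (- (ln n - ln (ln n))) / h' n / (1 + 1 / h' n) - 1)
      - 1 / lam * (real n * exp (- (exp lam * w n)) / (exp lam * w n) / (1 + 1 / h' n))) = (\<lambda>n. l n - a)"
    unfolding l_def split_exp[of "h' n" n for n]
    by (intro ext) (simp add: a_def algebra_simps diff_divide_distrib)
  finally have l: "(\<lambda>n. l n - a) \<in> O(g)" .
  have m: "(\<lambda>n. exp (- h' n)) \<in> O(g)"
    using lam unfolding w_def h'_def g_def by real_asymp
  have bound: "(\<lambda>n. \<bar>l n - a\<bar> + 2 * \<bar>u n - a\<bar> + 2 * a * exp (- h' n)) \<in> O(g)"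
    using l u m by (intro sum_in_bigo) auto
  have "eventually (\<lambda>n. norm ((\<Prod>i<n. 1 - exp (- (exp lam * w n * (1 - lam / real n) ^ i))) - exp (- a))
      \<le> 1 * norm (\<bar>l n - a\<bar> + 2 * \<bar>u n - a\<bar> + 2 * a * exp (- h' n))) at_top"
  proof -
    have "eventually (\<lambda>n. w n > 0) at_top" unfolding w_def by real_asymp
    moreover have "eventually (\<lambda>n::nat. real n > lam) at_top" by real_asymp
    moreover have "eventually (\<lambda>n. exp (- h' n) \<le> 1 / 2) at_top"
      using lam unfolding w_def h'_def by real_asymp
    ultimately show ?thesis
    proof eventually_elim
      case (elim n)
      define q where "q = 1 - lam / real n"
      define x where "x = exp lam * w n"
      have n: "n > 0" using elim lam by (auto intro: gr0I)
      have q: "0 < q" "q < 1" using elim lam n by (auto simp: q_def field_simps)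
      have x: "x > 0" using elim by (simp add: x_def)
      have lamn: "1 - q = lam / real n" by (simp add: q_def)
      have pow: "w n * exp (lam + real k * ln q) = x * q ^ k" for k
        using q by (simp add: x_def exp_add exp_of_nat_mult)
      have h: "h n = x * q ^ n" by (simp add: h_def pow flip: q_def)
      have h': "h' n = x * q ^ (n - 1)"
        using pow[of "n - 1"] n by (simp add: h'_def of_nat_diff flip: q_def)
      have pos: "h n > 0" "h' n > 0" using x q by (auto simp: h h')
      define S where "S = (\<Sum>i<n. exp (- (x * q ^ i)))"
      have "lam / real n * S \<le> exp (- h n) / h n"
        using sum_exp_geometric_le[OF x q, of n] by (simp add: h S_def lamn)
      then have Su: "S \<le> u n"
        using lam n pos by (simp add: u_def pos_le_divide_eq pos_divide_le_eq mult_ac)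
      \<comment> \<open>Taking k = n - 1 makes the range below \<open>Suc k\<close> equal to the
        full index range.\<close>
      have "exp (- h' n) / h' n - exp (- x) / x \<le> lam / real n * (1 + 1 / h' n) * S"
        using sum_exp_geometric_ge[OF x q, of "n - 1"] n by (simp add: h' S_def lamn)
      then have "real n / lam * (exp (- h' n) / h' n - exp (- x) / x)
          \<le> real n / lam * (lam / real n * (1 + 1 / h' n) * S)"
        using lam by (intro mult_left_mono) auto
      also have "\<dots> = S * (1 + 1 / h' n)" using lam n by simp
      finally have Sl: "l n \<le> S"
        using pos unfolding l_def x_def[symmetric] by (subst pos_divide_le_eq) (auto intro: add_pos_pos)
      \<comment> \<open>The last exponent \<open>h' n\<close> is the smallest, so
        \<open>exp (- h' n)\<close> serves as the uniform bound m.\<close>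
      have "0 \<le> exp (- (x * q ^ i)) \<and> exp (- (x * q ^ i)) \<le> exp (- h' n)" if "i \<in> {..<n}" for i
        using that x q by (auto simp: h' intro!: power_decreasing)
      from prod_one_minus_approx[OF this _ elim(3) _ Sl[unfolded S_def] Su[unfolded S_def], of a] lam
      show ?case by (simp add: x_def q_def a_def)
    qed
  qed
  from landau_o.big.trans[OF landau_o.bigI[OF zero_less_one this] bound]
  show ?thesis unfolding g_def a_def .
qed

section \<open>The distribution function\<close>

text \<open>The maximum is at most \<open>real n * s\<close> iff every \<open>T i\<close> is, so
  independence gives a product; the factor n cancels against the rate.\<close>

lemma (in prob_space) cdf_normalized_time:
  assumes lam: "lam > 0" "real n > lam"
    and indep: "indep_vars (\<lambda>_. borel) T {1..n}"
    and distr: "\<And>i. i \<in> {1..n} \<Longrightarrow> distributed M lborel (T i) (exponential_density (coupon_rate lam n i))"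
    and s: "s = t + exp lam / lam * (ln (real n) - ln (ln (real n)))" "s \<ge> 0"
  shows "cdf (distr M borel (normalized_time lam n T)) t
    = (\<Prod>i<n. 1 - exp (- (lam * s * (1 - lam / real n) ^ i)))"
proof -
  have n: "n > 0" using lam by (auto intro: gr0I)
  have meas: "T i \<in> borel_measurable M" if "i \<in> {1..n}" for i
    using distributed_measurable[OF distr[OF that]] by simp
  have "(\<lambda>\<omega>. Max ((\<lambda>i. T i \<omega>) ` {1..n})) \<in> borel_measurable M"
    by (intro borel_measurable_Max meas) auto
  then have [measurable]: "collection_time n T \<in> borel_measurable M"
    by (simp add: collection_time_def[abs_def])
  have [measurable]: "normalized_time lam n T \<in> borel_measurable M"
    unfolding normalized_time_def[abs_def] by measurable
  have iff: "normalized_time lam n T \<omega> \<le> t \<longleftrightarrow> (\<forall>i\<in>{1..n}. T i \<omega> \<le> real n * s)" for \<omega>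
  proof -
    have "normalized_time lam n T \<omega> \<le> t \<longleftrightarrow> collection_time n T \<omega> \<le> real n * s"
      using n by (simp add: normalized_time_def s divide_le_eq algebra_simps)
    also have "\<dots> \<longleftrightarrow> (\<forall>i\<in>{1..n}. T i \<omega> \<le> real n * s)"
      using n unfolding collection_time_def by (subst Max_le_iff) auto
    finally show ?thesis .
  qed
  have "cdf (distr M borel (normalized_time lam n T)) t
      = prob (normalized_time lam n T -` {..t} \<inter> space M)"
    by (simp add: cdf_def measure_distr)
  also have "normalized_time lam n T -` {..t} \<inter> space M
      = (\<Inter>i\<in>{1..n}. T i -` {..real n * s} \<inter> space M)"
    using n by (auto simp: iff)
  also have "prob \<dots> = (\<Prod>i\<in>{1..n}. prob (T i -` {..real n * s} \<inter> space M))"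
    using n by (intro indep_varsD_finite[OF indep]) auto
  also have "\<dots> = (\<Prod>i\<in>{1..n}. 1 - exp (- (lam * s * (1 - lam / real n) ^ (i - 1))))"
  proof (intro prod.cong refl)
    fix i assume i: "i \<in> {1..n}"
    have rate: "coupon_rate lam n i > 0"
      using lam n by (auto simp: coupon_rate_def field_simps)
    have "prob (T i -` {..real n * s} \<inter> space M) = \<P>(\<omega> in M. T i \<omega> \<le> real n * s)"
      by (intro arg_cong[where f = prob]) auto
    also have "\<dots> = 1 - exp (- (real n * s) * coupon_rate lam n i)"
      using s by (intro exponential_distributedD_le[OF distr[OF i] _ rate]) auto
    also have "- (real n * s) * coupon_rate lam n i = - (lam * s * (1 - lam / real n) ^ (i - 1))"
      using n by (simp add: coupon_rate_def)
    finally show "prob (T i -` {..real n * s} \<inter> space M)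
        = 1 - exp (- (lam * s * (1 - lam / real n) ^ (i - 1)))" .
  qed
  also have "\<dots> = (\<Prod>i<n. 1 - exp (- (lam * s * (1 - lam / real n) ^ i)))"
    by (rule prod.reindex_bij_witness[of _ Suc "\<lambda>i. i - 1"]) auto
  finally show ?thesis .
qed

theorem theorem1:
  fixes lam t' :: real
    and M :: "nat \<Rightarrow> 'a measure"
    and T :: "nat \<Rightarrow> nat \<Rightarrow> 'a \<Rightarrow> real"
  assumes "lam > 0"
    and "\<And>n. real n > lam \<Longrightarrow> prob_space (M n)"
    and "\<And>n. real n > lam \<Longrightarrow> prob_space.indep_vars (M n) (\<lambda>_. borel) (T n) {1..n}"
    and "\<And>n i. real n > lam \<Longrightarrow> i \<in> {1..n} \<Longrightarrow>
           distributed (M n) lborel (T n i) (exponential_density (coupon_rate lam n i))"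
  shows "(\<lambda>n. cdf (distr (M n) borel (normalized_time lam n (T n))) t'
            - exp (- exp (- ((t' - (- (exp lam / lam * ln lam))) / (exp lam / lam)))))
         \<in> O(\<lambda>n. ln (ln (real n)) / ln (real n))"
proof -
  \<comment> \<open>With this scaling \<open>lam * s\<close> becomes \<open>exp lam * w n\<close>,
    and the location parameter contributes the factor 1 / lam.\<close>
  define \<tau> where "\<tau> = t' / (exp lam / lam)"
  define w where "w = (\<lambda>n. \<tau> + ln (real n) - ln (ln (real n)))"
  have "(t' - (- (exp lam / lam * ln lam))) / (exp lam / lam) = \<tau> + ln lam"
    using assms(1) by (simp add: \<tau>_def field_simps)
  moreover have "exp (- (\<tau> + ln lam)) = exp (- \<tau>) / lam"
    using assms(1) by (simp add: exp_diff)
  ultimately have lim: "exp (- ((t' - (- (exp lam / lam * ln lam))) / (exp lam / lam))) = exp (- \<tau>) / lam"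
    by simp
  \<comment> \<open>Positivity of \<open>w n\<close> supplies \<open>s \<ge> 0\<close>; it holds
    only for large n, which suffices for the O-estimate.\<close>
  have "eventually (\<lambda>n. w n > 0) at_top" unfolding w_def by real_asymp
  moreover have "eventually (\<lambda>n::nat. real n > lam) at_top" by real_asymp
  ultimately have ev: "eventually (\<lambda>n. cdf (distr (M n) borel (normalized_time lam n (T n))) t'
      - exp (- (exp (- \<tau>) / lam))
      = (\<Prod>i<n. 1 - exp (- (exp lam * w n * (1 - lam / real n) ^ i))) - exp (- (exp (- \<tau>) / lam))) at_top"
  proof eventually_elim
    case (elim n)
    define s where "s = exp lam / lam * w n"
    have s: "s = t' + exp lam / lam * (ln (real n) - ln (ln (real n)))"
      using assms(1) by (simp add: s_def w_def \<tau>_def field_simps)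
    have "s \<ge> 0" using elim assms(1) by (simp add: s_def)
    from prob_space.cdf_normalized_time[OF assms(2)[OF elim(2)] assms(1) elim(2)
        assms(3)[OF elim(2)] assms(4)[OF elim(2)] s this]
    show ?case using assms(1) by (simp add: s_def)
  qed
  show ?thesis
    unfolding lim
    by (subst landau_o.big.in_cong[OF ev]) (use geometric_product_asymp[OF assms(1), of \<tau>] in \<open>simp add: w_def\<close>)
qed

end
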